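(* Let $d\ge2$ and $s\in(\frac12,1)$. Then there exists a scalar coefficient field $a\in L^1(\square_0)$, $a\ge1$, on $\square_0=(-\frac12,\frac12)^d$ such that $a\notin L^{1+\delta}(\square_0)$ for every $\delta>0$ and, for the coefficient field $\mathbf a=a\,\mathrm I_d$, $\Lambda_s(\square_0;\mathcal K)<\infty$ for every admissible cone $\mathcal K$.
   Context: Notation: $\square_m=(-\frac12 3^m,\frac12 3^m)^d$ for $m\in\mathbb Z$; $\fint_U$ is the average over $U$; $\mathfrak c_s=1-3^{-s}$. For a field $\mathbf a$ of symmetric positive semi-definite matrices, invertible a.e., with $\mathbf a,\mathbf a^{-1}\in L^1(U)$, $H^1_{\mathbf a}(U)$ is the completion of $C^\infty(\overline U)$ in the norm $(\|u\|_{L^2(U)}^2+\int_U\nabla u\cdot\mathbf a\nabla u)^{1/2}$. The admissible cones $\mathcal K(U)\subseteq H^1_{\mathbf a}(U)$ are the following families and their unions, where $\mathcal A(U)$ denotes the weak solutions $u\in H^1_{\mathbf a}(U)$ of $\nabla\cdot\mathbf a\nabla u=0$ in $U$ (tested against $C_c^\infty(U)$): (1) $\mathcal A(U)$; (2) the weak subsolutions ($\int_U\nabla\psi\cdot\mathbf a\nabla u\le0$ for all $0\le\psi\in C_c^\infty(U)$); (3) $\{\Phi(u)\in H^1_{\mathbf a}(U):u\in\mathcal A(U),\ \Phi:u(U)\to\mathbb R\ C^1\text{, convex, monotone}\}$; (4) $\{(u-k)_+:u\in\mathcal A(U),k\in\mathbb R\}$; (5) $\{\Phi(u)\in H^1_{\mathbf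 a}(U):u\in\mathcal A(U),u\ge0,\ \Phi'(u)=Cu^r,\ C,r\in\mathbb R,\ \Phi\text{ convex and monotone on }u(U)\}$; (6) $H^1_{\mathbf a}(U)$. $\mathbf a(U,p;\mathcal K)=\sup_{u\in\mathcal K(U)}\fint_U(-\nabla u\cdot\mathbf a\nabla u+2p\cdot\mathbf a\nabla u)$, $\|\mathbf a(U;\mathcal K)\|=\sup_{|p|=1}\mathbf a(U,p;\mathcal K)$, and $$\Lambda_s(\square_m;\mathcal K)=\Bigl(\mathfrak c_s\sum_{k=-\infty}^m3^{-s(m-k)}\max_{z\in3^k\mathbb Z^d\cap\square_m}\|\mathbf a(z+\square_k;\mathcal K)\|^{1/2}\Bigr)^2.$$ *)

theory Defs
  imports "HOL-Analysis.Analysis"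
begin

section \<open>Smooth functions\<close>

definition gradient :: "(real^'n \<Rightarrow> real) \<Rightarrow> real^'n \<Rightarrow> real^'n" where
  "gradient f x = (\<chi> i. frechet_derivative f (at x) (axis i 1))"

primrec C_k :: "nat \<Rightarrow> (real^'n \<Rightarrow> real) \<Rightarrow> bool" where
  "C_k 0 f \<longleftrightarrow> continuous_on UNIV f"
| "C_k (Suc k) f \<longleftrightarrow> f differentiable_on UNIV \<and> (\<forall>i. C_k k (\<lambda>x. gradient f x $ i))"

definition smooth :: "(real^'n \<Rightarrow> real) \<Rightarrow> bool" where
  "smooth f \<longleftrightarrow> (\<forall>k. C_k k f)"

definition test_functions :: "(real^'n) set \<Rightarrow> (real^'n \<Rightarrow> real) set" where
  "test_functions U =
     {\<psi>. smooth \<psi> \<and> compact (closure {x. \<psi> x \<noteq> 0}) \<and> closure {x. \<psi> x \<noteq> 0} \<subseteq> U}"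

section \<open>The weighted Sobolev space\<close>

type_synonym 'n matrix_field = "real^'n \<Rightarrow> real^'n^'n"

text \<open>An element of the Sobolev space is represented by a pair \<open>(u, g)\<close> of a function and its
  gradient; both are representatives of classes modulo equality a.e. in \<open>U\<close>.\<close>

type_synonym 'n sobolev = "(real^'n \<Rightarrow> real) \<times> (real^'n \<Rightarrow> real^'n)"

text \<open>The completion of the smooth functions on the closure of \<open>U\<close> (restrictions of functions
  that are smooth on the whole space) is realised inside \<open>L\<^sup>2(U)\<close> times the
  \<open>a\<close>-weighted \<open>L\<^sup>2(U)\<close>, as the closure of the pairs \<open>(\<phi>, \<nabla>\<phi>)\<close>.  If \<open>a\<close> and its
  inverse are integrable on \<open>U\<close>, all such \<open>\<phi>\<close> have finite norm when \<open>U\<close> is bounded, and \<open>g\<close> is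
  determined a.e. by \<open>u\<close> as its weak gradient.\<close>

definition H1_weighted :: "('n::finite) matrix_field \<Rightarrow> (real^'n) set \<Rightarrow> 'n sobolev set" where
  "H1_weighted a U = {(u, g).
     u \<in> borel_measurable (lebesgue_on U) \<and> g \<in> borel_measurable (lebesgue_on U) \<and>
     (\<exists>\<phi> :: nat \<Rightarrow> real^'n \<Rightarrow> real. (\<forall>j. smooth (\<phi> j)) \<and>
        (\<lambda>j. \<integral>\<^sup>+x. ennreal ((\<phi> j x - u x)\<^sup>2
               + (gradient (\<phi> j) x - g x) \<bullet> (a x *v (gradient (\<phi> j) x - g x)))
             \<partial>lebesgue_on U) \<longlonglongrightarrow> 0)}"

section \<open>Admissible cones\<close>

definition solutions :: "('n::finite) matrix_field \<Rightarrow> (real^'n) set \<Rightarrow> 'n sobolev set" where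
  "solutions a U = {(u, g) \<in> H1_weighted a U.
     \<forall>\<psi>\<in>test_functions U. (\<integral>x. gradient \<psi> x \<bullet> (a x *v g x) \<partial>lebesgue_on U) = 0}"

definition subsolutions :: "('n::finite) matrix_field \<Rightarrow> (real^'n) set \<Rightarrow> 'n sobolev set" where
  "subsolutions a U = {(u, g) \<in> H1_weighted a U.
     \<forall>\<psi>\<in>test_functions U. (\<forall>x. 0 \<le> \<psi> x) \<longrightarrow>
       (\<integral>x. gradient \<psi> x \<bullet> (a x *v g x) \<partial>lebesgue_on U) \<le> 0}"

text \<open>For the composition cones, the gradient component of \<open>\<Phi>(u)\<close> is the one it has as an element
  of the Sobolev space.  Since the image of a representative \<open>u\<close> need not be an interval, \<open>\<Phi>\<close> is
  taken on its convex hull; \<open>u\<close> ranges over all representatives of a class, so this amounts to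
  asking for some interval that contains a.e. value of \<open>u\<close> and on which \<open>\<Phi>\<close> is as required.
  ``Monotone'' means nondecreasing or nonincreasing.\<close>

definition convex_images :: "('n::finite) matrix_field \<Rightarrow> (real^'n) set \<Rightarrow> 'n sobolev set" where
  "convex_images a U = {(v, h) \<in> H1_weighted a U.
     \<exists>u g \<Phi> \<Phi>'. (u, g) \<in> solutions a U \<and>
       (let J = convex hull (u ` U) in
         (\<forall>t\<in>J. (\<Phi> has_real_derivative \<Phi>' t) (at t within J)) \<and> continuous_on J \<Phi>' \<and>
         convex_on J \<Phi> \<and> (mono_on J \<Phi> \<or> antimono_on J \<Phi>)) \<and>
       (AE x in lebesgue_on U. v x = \<Phi> (u x))}"

definition truncations :: "('n::finite) matrix_field \<Rightarrow> (real^'n) set \<Rightarrow> 'n sobolev set" where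
  "truncations a U = {(v, h) \<in> H1_weighted a U.
     \<exists>u g k. (u, g) \<in> solutions a U \<and> (AE x in lebesgue_on U. v x = max (u x - k) 0)}"

text \<open>The identity \<open>\<Phi>'(t) = C t\<^sup>r\<close> is imposed at \<open>t > 0\<close>.  At \<open>t = 0\<close>, where the power may
  be infinite (and where \<open>powr\<close> is always \<open>0\<close>, even for \<open>r = 0\<close>), only continuity of \<open>\<Phi>\<close> is
  required; for \<open>r \<ge> 0\<close> this already forces the identity there, with \<open>0\<^sup>0 = 1\<close>.\<close>

definition power_images :: "('n::finite) matrix_field \<Rightarrow> (real^'n) set \<Rightarrow> 'n sobolev set" where
  "power_images a U = {(v, h) \<in> H1_weighted a U.
     \<exists>u g \<Phi> C r. (u, g) \<in> solutions a U \<and> (\<forall>x\<in>U. 0 \<le> u x) \<and>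
       (let J = convex hull (u ` U) in
         (\<forall>t\<in>J. 0 < t \<longrightarrow> (\<Phi> has_real_derivative C * t powr r) (at t within J)) \<and>
         continuous_on J \<Phi> \<and> convex_on J \<Phi> \<and> (mono_on J \<Phi> \<or> antimono_on J \<Phi>)) \<and>
       (AE x in lebesgue_on U. v x = \<Phi> (u x))}"

definition admissible_cones ::
    "('n::finite) matrix_field \<Rightarrow> ((real^'n) set \<Rightarrow> 'n sobolev set) set" where
  "admissible_cones a = {(\<lambda>U. \<Union>F\<in>\<F>. F a U) | \<F>.
     \<F> \<noteq> {} \<and> \<F> \<subseteq> {solutions, subsolutions, convex_images, truncations, power_images, H1_weighted}}"

section \<open>Coarse-grained ellipticity\<close>

definition coarse_grained ::
    "('n::finite) matrix_field \<Rightarrow> ((real^'n) set \<Rightarrow> 'n sobolev set) \<Rightarrow> (real^'n) set \<Rightarrow> real^'n \<Rightarrow> ereal"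
  where
  "coarse_grained a K U p = (SUP (u, g)\<in>K U.
     ereal ((\<integral>x. - (g x \<bullet> (a x *v g x)) + 2 * (p \<bullet> (a x *v g x)) \<partial>lebesgue_on U)
       / measure lebesgue U))"

definition coarse_grained_norm ::
    "('n::finite) matrix_field \<Rightarrow> ((real^'n) set \<Rightarrow> 'n sobolev set) \<Rightarrow> (real^'n) set \<Rightarrow> ereal" where
  "coarse_grained_norm a K U = (SUP p\<in>{p. norm p = 1}. coarse_grained a K U p)"

definition cube :: "int \<Rightarrow> (real^'n) set" where
  "cube m = {x. \<forall>i. - (1/2) * 3 powi m < x $ i \<and> x $ i < (1/2) * 3 powi m}"

definition lattice_points :: "int \<Rightarrow> (real^'n) set" where
  "lattice_points k = {z. \<forall>i. \<exists>j::int. z $ i = 3 powi k * of_int j}"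

definition sqrt_ennreal :: "ennreal \<Rightarrow> ennreal" where
  "sqrt_ennreal x = (if x = \<infinity> then \<infinity> else ennreal (sqrt (enn2real x)))"

text \<open>Admissible cones contain \<open>0\<close>, so the norm is nonnegative and \<open>e2ennreal\<close> loses nothing.
  The supremum over \<open>z\<close> is over a finite nonempty set, hence a maximum.\<close>

definition Lambda ::
    "real \<Rightarrow> ('n::finite) matrix_field \<Rightarrow> ((real^'n) set \<Rightarrow> 'n sobolev set) \<Rightarrow> int \<Rightarrow> ennreal" where
  "Lambda s a K m =
     (ennreal (1 - 3 powr (- s)) *
       (\<Sum>\<^sub>\<infinity>k\<in>{..m}. ennreal (3 powr (- s * of_int (m - k))) *
          (SUP z\<in>lattice_points k \<inter> cube m.
             sqrt_ennreal (e2ennreal (coarse_grained_norm a K ((+) z ` cube k))))))\<^sup>2"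

end

theory Submission
  imports Defs
begin

text \<open>Pointwise, \<open>- g \<cdot> ag + 2 p \<cdot> ag \<le> p \<cdot> ap\<close>, so on any cube and for every cone the coarse-grained
  coefficient is at most the average of \<open>a\<close>.  Let \<open>a\<close> depend on one coordinate only and be
  integrable in it: its average over a cube of side \<open>3\<^sup>k\<close> is then \<open>O(3\<^sup>-\<^sup>k)\<close>, and the series
  defining \<open>\<Lambda>\<^sub>s\<close> is dominated by a geometric one of ratio \<open>3 powr (1/2 - s) < 1\<close>.  The profile
  puts height \<open>2 ^ (n\<^sup>2 + n + 1)\<close> on a slab of width \<open>2 ^ -(n + 1)\<^sup>2\<close>, which contributes \<open>2 ^ -n\<close>
  to the integral of \<open>a\<close>, but an unbounded amount to that of \<open>a powr (1 + \<delta>)\<close>.\<close>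

section \<open>Bounds by averages and summation over scales\<close>

lemma coarse_grained_norm_scalar_le:
  fixes a :: "real^'n::finite \<Rightarrow> real"
  assumes a: "integrable (lebesgue_on U) a" and nonneg: "\<And>x. 0 \<le> a x"
  shows "coarse_grained_norm (\<lambda>x. a x *\<^sub>R mat 1) K U
    \<le> ereal ((\<integral>x. a x \<partial>lebesgue_on U) / measure lebesgue U)"
  unfolding coarse_grained_norm_def coarse_grained_def
proof (intro SUP_least, clarsimp simp flip: scaleR_matrix_vector_assoc, rule divide_right_mono)
  fix p :: "real^'n" and u :: "real^'n \<Rightarrow> real" and g :: "real^'n \<Rightarrow> real^'n"
  assume p: "norm p = 1"
  have "2 * (a x * (p \<bullet> g x)) - a x * (g x \<bullet> g x) \<le> a x" for x
  proof -
    \<comment> \<open>Completing the square: this term is exactly the gap in the claimed inequality,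
      and \<open>norm p = 1\<close> turns \<open>a x * (p \<bullet> p)\<close> into
      \<open>a x\<close>.\<close>
    have "0 \<le> a x * (norm (g x - p))\<^sup>2"
      using nonneg by simp
    also have "\<dots> = a x * (g x \<bullet> g x) - 2 * (a x * (p \<bullet> g x)) + a x"
      using p by (simp add: power2_norm_eq_inner inner_diff inner_commute algebra_simps norm_eq_1)
    finally show ?thesis by simp
  qed
  \<comment> \<open>For an arbitrary \<open>g\<close> the left integrand may fail to be integrable.
    Its integral is then 0 by convention, which is still below the right side because
    \<open>a\<close> is nonnegative; \<open>integral_mono'\<close> covers both cases.\<close>
  then show "(\<integral>x. 2 * (a x * (p \<bullet> g x)) - a x * (g x \<bullet> g x) \<partial>lebesgue_on U)
      \<le> (\<integral>x. a x \<partial>lebesgue_on U)"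
    using a nonneg by (intro integral_mono') auto
qed simp

lemma sqrt_ennreal_le:
  assumes "x \<le> ennreal b" and "0 \<le> b"
  shows "sqrt_ennreal x \<le> ennreal (sqrt b)"
proof -
  have "x \<noteq> \<infinity>"
    using assms by (auto simp: top_unique)
  moreover have "enn2real x \<le> b"
    using enn2real_mono[OF assms(1)] assms(2) by simp
  ultimately show ?thesis
    using assms by (simp add: sqrt_ennreal_def ennreal_leI)
qed

text \<open>The square root halves the growth rate: at scale \<open>k = m - n\<close> the norms
  contribute at most a constant times \<open>3 powr (n/2)\<close>, against the weight
  \<open>3 powr (- s * n)\<close>. The product is \<open>C * q ^ n\<close>, and \<open>q < 1\<close>
  is exactly the condition \<open>1/2 < s\<close>.\<close>

lemma Lambda_finite:
  fixes a :: "('n::finite) matrix_field"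
  assumes B: "0 \<le> B"
    and bound: "\<And>k z. k \<le> m \<Longrightarrow>
      coarse_grained_norm a K ((+) z ` cube k) \<le> ereal (B * 3 powr - real_of_int k)"
    and s: "1/2 < s"
  shows "Lambda s a K m < \<infinity>"
proof -
  define C where "C = sqrt B * 3 powr (- real_of_int m / 2)"
  define q :: real where "q = 3 powr (1/2 - s)"
  have q: "0 \<le> q" "q < 1"
    using s by (auto simp: q_def powr_less_one)
  define t where "t k = ennreal (3 powr (- s * of_int (m - k))) *
          (SUP z\<in>lattice_points k \<inter> cube m.
             sqrt_ennreal (e2ennreal (coarse_grained_norm a K ((+) z ` cube k))))" for k
  have t: "t (m - int n) \<le> ennreal (C * q ^ n)" for n
  proof -
    let ?b = "B * 3 powr - real_of_int (m - int n)"
    have "(SUP z\<in>lattice_points (m - int n) \<inter> cube m.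
        sqrt_ennreal (e2ennreal (coarse_grained_norm a K ((+) z ` cube (m - int n)))))
      \<le> ennreal (sqrt ?b)"
    proof (intro SUP_least sqrt_ennreal_le)
      fix z :: "real^'n"
      have "e2ennreal (coarse_grained_norm a K ((+) z ` cube (m - int n))) \<le> e2ennreal (ereal ?b)"
        by (intro e2ennreal_mono bound) simp
      then show "e2ennreal (coarse_grained_norm a K ((+) z ` cube (m - int n))) \<le> ennreal ?b"
        by (simp add: e2ennreal_ereal)
    qed (use B in simp)
    then have "t (m - int n) \<le> ennreal (3 powr (- s * n)) * ennreal (sqrt ?b)"
      unfolding t_def by (intro mult_mono) auto
    also have "\<dots> = ennreal (3 powr (- s * n) * sqrt ?b)"
      using B by (simp add: ennreal_mult)
    also have "3 powr (- s * n) * sqrt ?b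
        = sqrt B * 3 powr (- s * n + - real_of_int (m - int n) / 2)"
      using powr_half_sqrt_powr[of 3 "- real_of_int (m - int n)"]
      by (simp only: real_sqrt_mult powr_add) simp
    also have "- s * n + - real_of_int (m - int n) / 2 = - real_of_int m / 2 + (1/2 - s) * n"
      by (simp add: field_simps)
    also have "sqrt B * 3 powr (- real_of_int m / 2 + (1/2 - s) * n) = C * q ^ n"
      by (simp only: C_def q_def powr_add) (simp add: powr_power mult.commute)
    finally show ?thesis .
  qed
  have "(\<lambda>n::nat. m - int n) ` UNIV = {..m}"
    by (auto simp: image_iff) (metis zle_iff_zadd add_diff_cancel_right')
  then have "(\<Sum>\<^sub>\<infinity>k\<in>{..m}. t k) = (\<Sum>\<^sub>\<infinity>n. t (m - int n))"
    using infsum_reindex[of "\<lambda>n. m - int n" UNIV t] by (auto simp: inj_on_def o_def)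
  also have "\<dots> \<le> (\<Sum>\<^sub>\<infinity>n. ennreal (C * q ^ n))"
    by (intro infsum_mono nonneg_summable_on_complete t) auto
  \<comment> \<open>An infinite sum in \<open>ennreal\<close> is bounded once all its finite partial
    sums are, and these are compared with the real geometric series.\<close>
  also have "\<dots> \<le> ennreal (\<Sum>n. C * q ^ n)"
  proof (intro infsum_le_finite_sums nonneg_summable_on_complete)
    fix F :: "nat set"
    assume "finite F"
    then have "(\<Sum>n\<in>F. C * q ^ n) \<le> (\<Sum>n. C * q ^ n)"
      using q B by (intro sum_le_suminf summable_mult summable_geometric) (auto simp: C_def)
    then show "(\<Sum>n\<in>F. ennreal (C * q ^ n)) \<le> ennreal (\<Sum>n. C * q ^ n)"
      using q B by (simp add: C_def sum_nonneg ennreal_leI)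
  qed auto
  also have "\<dots> < \<infinity>"
    by simp
  finally have "(\<Sum>\<^sub>\<infinity>k\<in>{..m}. t k) < \<infinity>" .
  then show ?thesis
    unfolding Lambda_def t_def[symmetric] 
    by (simp add: ennreal_mult_less_top power2_eq_square)
qed

section \<open>Slabs and spikes in one coordinate\<close>

definition slab :: "'n \<Rightarrow> nat \<Rightarrow> (real^'n) set" where
  "slab i n = {x. 0 < x $ i \<and> x $ i < (1/2) ^ (n + 1)\<^sup>2}"

definition spike :: "'n \<Rightarrow> real^'n \<Rightarrow> nat \<Rightarrow> real" where
  "spike i x n = 2 ^ (n\<^sup>2 + n + 1) * indicator (slab i n) x"

text \<open>Each point lies in only finitely many slabs: their widths tend to 0 and they exclude
  \<open>x $ i \<le> 0\<close>. So the series is a finite sum at every point, and the field built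
  from it is real-valued everywhere.\<close>

lemma summable_spike: "summable (spike i x)"
proof -
  have "eventually (\<lambda>n. spike i x n = 0) sequentially"
  proof (cases "0 < x $ i")
    case True
    have "(\<lambda>n. (1/2::real) ^ n) \<longlonglongrightarrow> 0"
      by (rule LIMSEQ_realpow_zero) auto
    then have "eventually (\<lambda>n. (1/2) ^ n < x $ i) sequentially"
      using True by (rule order_tendstoD)
    then show ?thesis
    proof eventually_elim
      fix n
      have "(1/2::real) ^ (n + 1)\<^sup>2 \<le> (1/2) ^ n"
        by (intro power_decreasing) (auto simp: power2_eq_square)
      also assume "(1/2) ^ n < x $ i"
      finally show "spike i x n = 0"
        by (simp add: spike_def slab_def)
    qed
  qed (simp add: spike_def slab_def)
  then show ?thesis
    by (simp add: summable_cong)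
qed

section \<open>Measures of cubes and of their intersections with slabs\<close>

lemma cube_translate_eq_box:
  "(+) z ` cube k = box (z - (\<chi> i. 3 powi k / 2)) (z + (\<chi> i. 3 powi k / 2))"
proof -
  have "x \<in> (+) z ` cube k \<longleftrightarrow> x - z \<in> cube k" for x
    by (metis (no_types, lifting) add_diff_cancel_left' diff_add_cancel add.commute image_iff)
  moreover have "- (1/2) * w < a - b \<and> a - b < 1/2 * w \<longleftrightarrow> b - w/2 < a \<and> a < b + w/2" for a b w :: real
    by auto
  ultimately show ?thesis
    by (simp add: set_eq_iff cube_def mem_box_cart)
qed

lemma measure_box_cart:
  fixes l u :: "real^'n::finite"
  assumes "\<And>j. l $ j \<le> u $ j"
  shows "measure lebesgue (box l u) = (\<Prod>j\<in>UNIV. u $ j - l $ j)"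
proof -
  have "measure lebesgue (box l u) = measure lborel (cbox l u)"
    by (simp add: measure_lborel_box_eq measure_lborel_cbox_eq)
  also have "\<dots> = (\<Prod>j\<in>UNIV. u $ j - l $ j)"
    using assms by (subst content_cbox_cart) (auto simp: interval_ne_empty_cart)
  finally show ?thesis .
qed

lemma measure_cube_translate:
  "measure lebesgue ((+) (z::real^'n::finite) ` cube k) = (3 powi k) ^ CARD('n)"
  unfolding cube_translate_eq_box by (subst measure_box_cart) auto

lemma lmeasurable_cube_translate: "(+) (z::real^'n::finite) ` cube k \<in> lmeasurable"
  unfolding cube_translate_eq_box by simp

lemma finite_measure_lebesgue_on: "S \<in> lmeasurable \<Longrightarrow> finite_measure (lebesgue_on S)"
  by (rule finite_measureI) (auto simp: emeasure_restrict_space space_restrict_space fmeasurable_def)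

lemma slab_measurable [measurable]: "slab i n \<in> sets borel"
  unfolding slab_def by measurable

text \<open>The box \<open>b\<close> is the cube with its side in direction \<open>i\<close>
  replaced by the full width of the slab. The first inclusion serves the upper bound on integrals
  over arbitrary cubes; the reverse one, on the unit cube, serves the lower bound behind
  non-integrability.\<close>

lemma slab_Int_cube_translate:
  fixes z :: "real^'n::finite" and k :: int and n :: nat and i :: 'n
  defines "h \<equiv> 3 powi k / 2"
  defines "b \<equiv> box (\<chi> j. if j = i then 0 else z $ j - h)
      (\<chi> j. if j = i then (1/2) ^ (n + 1)\<^sup>2 else z $ j + h)"
  shows "slab i n \<inter> (+) z ` cube k \<subseteq> b"
    and "z = 0 \<Longrightarrow> k = 0 \<Longrightarrow> b \<subseteq> slab i n \<inter> cube 0"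
    and "measure lebesgue b = (1/2) ^ (n + 1)\<^sup>2 * (3 powi k) ^ (CARD('n) - 1)"
proof -
  show "slab i n \<inter> (+) z ` cube k \<subseteq> b"
    unfolding cube_translate_eq_box by (auto simp: b_def h_def slab_def mem_box_cart)
  show "b \<subseteq> slab i n \<inter> cube 0" if "z = 0" "k = 0"
  proof
    fix x
    assume x: "x \<in> b"
    \<comment> \<open>Even the widest slab, \<open>n = 0\<close>, has width 1/2, the half side of
      \<open>cube 0\<close>.\<close>
    have "(1/2::real) ^ (n + 1)\<^sup>2 \<le> (1/2) ^ 1"
      by (intro power_decreasing) auto
    moreover have "(if j = i then 0 else - (1/2)) < x $ j \<and>
        x $ j < (if j = i then (1/2) ^ (n + 1)\<^sup>2 else 1/2)" for j
      using x unfolding b_def h_def mem_box_cart that by (auto dest: spec[of _ j])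
    from this[of i] this have "- (1/2) < x $ j \<and> x $ j < 1/2 \<and> 0 < x $ i \<and>
        x $ i < (1/2) ^ (n + 1)\<^sup>2" for j
      using calculation by (cases "j = i") (auto dest: meta_spec[of _ j])
    then show "x \<in> slab i n \<inter> cube 0"
      by (auto simp: slab_def cube_def)
  qed
  have "measure lebesgue b = (\<Prod>j\<in>UNIV. if j = i then (1/2) ^ (n + 1)\<^sup>2 else 2 * h)"
    unfolding b_def by (subst measure_box_cart) (auto simp: h_def intro!: prod.cong)
  also have "\<dots> = (1/2) ^ (n + 1)\<^sup>2 * (\<Prod>j\<in>UNIV - {i}. 2 * h)"
    by (subst prod.remove[of _ i]) (auto intro!: prod.cong)
  finally show "measure lebesgue b = (1/2) ^ (n + 1)\<^sup>2 * (3 powi k) ^ (CARD('n) - 1)"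
    by (simp add: h_def card_Diff_singleton)
qed

text \<open>Since \<open>(n + 1)^2 = (n^2 + n + 1) + n\<close>, height times width is
  \<open>(1/2) ^ n\<close>; the other sides of the cube give the power of \<open>3 powi k\<close>.
  Wherever the cube lies, the whole slab width is counted, which costs the factor
  \<open>3 powi (-k)\<close> in the average.\<close>

lemma spike_integral:
  fixes z :: "real^'n::finite" and k :: int
  defines "Q \<equiv> (+) z ` cube k"
  shows "integrable (lebesgue_on Q) (\<lambda>x. spike i x n)"
    and "(\<integral>x. spike i x n \<partial>lebesgue_on Q) \<le> (3 powi k) ^ (CARD('n) - 1) * (1/2) ^ n"
proof -
  have Q: "Q \<in> lmeasurable"
    unfolding Q_def by (rule lmeasurable_cube_translate)
  then interpret finite_measure "lebesgue_on Q"
    by (rule finite_measure_lebesgue_on)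
  have slab: "slab i n \<in> sets lebesgue"
    by simp
  show "integrable (lebesgue_on Q) (\<lambda>x. spike i x n)"
    unfolding spike_def
    by (intro integrable_mult_right integrable_const_bound[of _ 1]
        measurable_restrict_space1[OF borel_measurable_indicator[OF slab]]) auto
  have "(\<integral>x. spike i x n \<partial>lebesgue_on Q) = 2 ^ (n\<^sup>2 + n + 1) * measure (lebesgue_on Q) (slab i n \<inter> Q)"
    unfolding spike_def by simp
  also have "measure (lebesgue_on Q) (slab i n \<inter> Q) = measure lebesgue (slab i n \<inter> Q)"
    using Q by (intro measure_restrict_space) auto
  also have "\<dots> \<le> (1/2) ^ (n + 1)\<^sup>2 * (3 powi k) ^ (CARD('n) - 1)"
    unfolding Q_def slab_Int_cube_translate(3)[where z = z and i = i, symmetric]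
    using Q slab by (intro measure_mono_fmeasurable slab_Int_cube_translate(1)) (auto simp: Q_def)
  also have "2 ^ (n\<^sup>2 + n + 1) * ((1/2) ^ (n + 1)\<^sup>2 * (3 powi k) ^ (CARD('n) - 1))
      = (3 powi k) ^ (CARD('n) - 1) * (1/2::real) ^ n"
  proof -
    have "(1/2::real) ^ (n + 1)\<^sup>2 = (1/2) ^ (n\<^sup>2 + n + 1) * (1/2) ^ n"
      by (simp add: power2_eq_square ac_simps flip: power_add)
    then show ?thesis
      by (simp add: power_one_over)
  qed
  finally show "(\<integral>x. spike i x n \<partial>lebesgue_on Q) \<le> (3 powi k) ^ (CARD('n) - 1) * (1/2) ^ n"
    by simp
qed

section \<open>The coefficient field and its integrability\<close>

definition spikes :: "'n \<Rightarrow> real^'n \<Rightarrow> real" where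
  "spikes i x = 1 + (\<Sum>n. spike i x n)"

lemma spike_nonneg: "0 \<le> spike i x n"
  by (simp add: spike_def)

lemma spikes_ge_1: "1 \<le> spikes i x"
  by (simp add: spikes_def suminf_nonneg summable_spike spike_nonneg)

lemma spikes_ge_spike: "spike i x n \<le> spikes i x"
  using sum_le_suminf[OF summable_spike, of "{n}" i x] by (simp add: spikes_def spike_nonneg)

lemma spikes_integral:
  fixes z :: "real^'n::finite" and k :: int
  defines "Q \<equiv> (+) z ` cube k"
  shows "integrable (lebesgue_on Q) (spikes i)"
    and "(\<integral>x. spikes i x \<partial>lebesgue_on Q)
      \<le> (3 powi k) ^ CARD('n) + 2 * (3 powi k) ^ (CARD('n) - 1)"
proof -
  let ?w = "(3 powi k) ^ (CARD('n) - 1) :: real"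
  have Q: "Q \<in> lmeasurable"
    unfolding Q_def by (rule lmeasurable_cube_translate)
  then interpret finite_measure "lebesgue_on Q"
    by (rule finite_measure_lebesgue_on)
  have half: "summable (\<lambda>n. ?w * (1/2) ^ n)"
    by (intro summable_mult summable_geometric) simp
  \<comment> \<open>Domination by the geometric series; this justifies both the integrability of the
    sum and its termwise integration.\<close>
  have sum: "summable (\<lambda>n. \<integral>x. spike i x n \<partial>lebesgue_on Q)"
    using spike_integral(2)[where z = z and k = k and i = i]
    by (intro summable_comparison_test'[OF half, of 0]) (auto simp: Q_def spike_nonneg integral_nonneg_AE)
  note S = spike_integral(1)[where z = z and k = k and i = i, folded Q_def]
  have int: "integrable (lebesgue_on Q) (\<lambda>x. \<Sum>n. spike i x n)"
    using S summable_spike sum by (intro integrable_suminf) (auto simp: spike_nonneg)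
  then show "integrable (lebesgue_on Q) (spikes i)"
    unfolding spikes_def by simp
  have "(\<integral>x. spikes i x \<partial>lebesgue_on Q)
      = measure (lebesgue_on Q) Q + (\<integral>x. (\<Sum>n. spike i x n) \<partial>lebesgue_on Q)"
    unfolding spikes_def using int by (simp add: space_restrict_space)
  also have "measure (lebesgue_on Q) Q = (3 powi k) ^ CARD('n)"
    using Q by (simp add: measure_restrict_space Q_def measure_cube_translate)
  also have "(\<integral>x. (\<Sum>n. spike i x n) \<partial>lebesgue_on Q) = (\<Sum>n. \<integral>x. spike i x n \<partial>lebesgue_on Q)"
    using S summable_spike sum by (intro integral_suminf) (auto simp: spike_nonneg)
  also have "\<dots> \<le> (\<Sum>n. ?w * (1/2) ^ n)"
    using spike_integral(2)[where z = z and k = k and i = i] by (intro suminf_le sum half) (simp add: Q_def)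
  also have "\<dots> = ?w * 2"
    by (subst suminf_mult) (auto simp: suminf_geometric)
  finally show "(\<integral>x. spikes i x \<partial>lebesgue_on Q) \<le> (3 powi k) ^ CARD('n) + 2 * ?w"
    by simp
qed

text \<open>On a box of measure \<open>2 powr - (N + n)\<close> the field is at least
  \<open>2 ^ N\<close>, so the integral is at least \<open>2 powr (\<delta> * N - n)\<close>. As
  \<open>N\<close> is quadratic in \<open>n\<close>, this is unbounded for every positive
  \<delta>.\<close>

lemma spikes_powr_not_integrable:
  fixes i :: "'n::finite"
  assumes \<delta>: "0 < \<delta>"
  shows "\<not> integrable (lebesgue_on (cube 0)) (\<lambda>x. \<bar>spikes i x\<bar> powr (1 + \<delta>))"
proof
  assume int: "integrable (lebesgue_on (cube 0)) (\<lambda>x. \<bar>spikes i x\<bar> powr (1 + \<delta>))"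
  define I where "I = (\<integral>x. \<bar>spikes i x\<bar> powr (1 + \<delta>) \<partial>lebesgue_on (cube 0))"
  \<comment> \<open>The bound \<open>2 / \<delta> < n\<close> yields
    \<open>2 * n \<le> \<delta> * N\<close>, hence \<open>2 powr n \<le> I\<close>; the bound
    \<open>I < n\<close> then contradicts \<open>n < 2 powr n\<close>.\<close>
  obtain n :: nat where n: "max (2 / \<delta>) I < real n"
    using reals_Archimedean2 by blast
  define N where "N = n\<^sup>2 + n + 1"
  define b :: "(real^'n) set" where "b = box (\<chi> j. if j = i then 0 else 0 $ j - 3 powi 0 / 2)
      (\<chi> j. if j = i then (1/2) ^ (n + 1)\<^sup>2 else 0 $ j + 3 powi 0 / 2)"
  have b: "b \<subseteq> slab i n \<inter> cube 0" "measure lebesgue b = (1/2) ^ (n + 1)\<^sup>2"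
    unfolding b_def using slab_Int_cube_translate(2,3)[where z = 0 and k = 0 and i = i and n = n]
    by auto
  have cube: "cube 0 \<in> lmeasurable"
    using lmeasurable_cube_translate[of 0 0] by simp
  then interpret finite_measure "lebesgue_on (cube 0)"
    by (rule finite_measure_lebesgue_on)
  have "b \<in> sets lebesgue"
    unfolding b_def by simp
  then have "b \<in> sets (lebesgue_on (cube 0))"
    using b fmeasurableD[OF cube] by (subst sets_restrict_space_iff) auto
  then have "integrable (lebesgue_on (cube 0)) (indicator b :: _ \<Rightarrow> real)"
    by (intro integrable_const_bound[of _ 1]) auto
  then have "(\<integral>x. (2 ^ N) powr (1 + \<delta>) * indicator b x \<partial>lebesgue_on (cube 0)) \<le> I"
    unfolding I_def
  proof (intro integral_mono int integrable_mult_right)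
    fix x
    show "(2 ^ N) powr (1 + \<delta>) * indicator b x \<le> \<bar>spikes i x\<bar> powr (1 + \<delta>)"
      using b spikes_ge_spike[of i x n] \<delta>
      by (auto simp: indicator_def spike_def N_def intro!: powr_mono2)
  qed auto
  also have "(\<integral>x. (2 ^ N) powr (1 + \<delta>) * indicator b x \<partial>lebesgue_on (cube 0))
      = (2 ^ N) powr (1 + \<delta>) * (1/2) ^ (n + 1)\<^sup>2"
    using b fmeasurableD[OF cube]
    by (subst (asm) measure_restrict_space[of "cube 0" lebesgue b, symmetric])
      (auto simp: space_restrict_space Int_absorb2)
  also have "\<dots> = 2 powr (\<delta> * N - n)"
  proof -
    have "(n + 1)\<^sup>2 = N + n"
      by (simp add: N_def power2_eq_square)
    then have "(1/2::real) ^ (n + 1)\<^sup>2 = 2 powr - real (N + n)"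
      by (simp only: powr_minus powr_realpow power_one_over inverse_eq_divide zero_less_numeral)
    moreover have "(2 ^ N) powr (1 + \<delta>) = 2 powr (N * (1 + \<delta>))"
      by (simp add: powr_powr[symmetric] powr_realpow)
    moreover have "\<delta> * N - n = N * (1 + \<delta>) + - real (N + n)"
      by (simp add: algebra_simps)
    ultimately show ?thesis
      by (simp only: powr_add)
  qed
  finally have I: "2 powr (\<delta> * N - n) \<le> I" .
  have "2 * real n \<le> \<delta> * N"
  proof -
    have "2 * real n \<le> \<delta> * n * n"
      using n \<delta> by (intro mult_right_mono) (auto simp: field_simps)
    also have "\<dots> \<le> \<delta> * N"
      using \<delta> by (simp add: N_def power2_eq_square mult.assoc)
    finally show ?thesis .
  qed
  then have "2 powr n \<le> 2 powr (\<delta> * N - n)"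
    by simp
  also note I
  also have "I < n"
    using n by simp
  finally have "2 powr n < real n" .
  moreover have "real n < 2 powr n"
    using of_nat_less_two_power[of n, where 'a = real] by (simp add: powr_realpow)
  ultimately show False
    by simp
qed

section \<open>Finiteness of \<open>Lambda\<close> for the spike field\<close>

theorem proposition6p1:
  fixes s :: real
  assumes "2 \<le> CARD('n::finite)" and "1/2 < s" and "s < 1"
  shows "\<exists>a :: real^'n \<Rightarrow> real.
    integrable (lebesgue_on (cube 0)) a \<and>
    (\<forall>x\<in>cube 0. 1 \<le> a x) \<and>
    (\<forall>\<delta>>0. \<not> integrable (lebesgue_on (cube 0)) (\<lambda>x. \<bar>a x\<bar> powr (1 + \<delta>))) \<and>
    (\<forall>K\<in>admissible_cones (\<lambda>x. a x *\<^sub>R mat 1).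
       Lambda s (\<lambda>x. a x *\<^sub>R mat 1) K 0 < \<infinity>)"
proof -
  \<comment> \<open>Any coordinate direction will do for the spikes.\<close>
  fix i :: 'n
  show ?thesis
  proof (intro exI[of _ "spikes i"] conjI ballI allI impI)
    show "integrable (lebesgue_on (cube 0)) (spikes i)"
      using spikes_integral(1)[of 0 0 i] by simp
    show "1 \<le> spikes i x" for x
      by (rule spikes_ge_1)
    show "\<not> integrable (lebesgue_on (cube 0)) (\<lambda>x. \<bar>spikes i x\<bar> powr (1 + \<delta>))" if "0 < \<delta>" for \<delta>
      using that by (rule spikes_powr_not_integrable)
    \<comment> \<open>With side \<open>?w \<le> 1\<close> the average of the field is at most
      \<open>1 + 2 / ?w \<le> 3 / ?w\<close>, whence the constant 3.\<close>
    show "Lambda s (\<lambda>x. spikes i x *\<^sub>R mat 1) K 0 < \<infinity>" for K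
    proof (rule Lambda_finite[where B = 3])
      fix k :: int and z :: "real^'n"
      assume "k \<le> 0"
      let ?Q = "(+) z ` cube k" and ?w = "3 powi k :: real"
      have w: "0 < ?w" "?w \<le> 1"
        using \<open>k \<le> 0\<close> power_int_increasing[of k 0 "3::real"] by auto
      have "coarse_grained_norm (\<lambda>x. spikes i x *\<^sub>R mat 1) K ?Q
          \<le> ereal ((\<integral>x. spikes i x \<partial>lebesgue_on ?Q) / measure lebesgue ?Q)"
        by (intro coarse_grained_norm_scalar_le spikes_integral order_trans[OF zero_le_one spikes_ge_1])
      also have "(\<integral>x. spikes i x \<partial>lebesgue_on ?Q) / measure lebesgue ?Q
          \<le> (?w ^ CARD('n) + 2 * ?w ^ (CARD('n) - 1)) / ?w ^ CARD('n)"
        unfolding measure_cube_translate by (intro divide_right_mono spikes_integral) simp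
      also have "\<dots> = 1 + 2 / ?w"
        using w power_minus_mult[of "CARD('n)" ?w, symmetric] by (simp add: add_divide_distrib)
      also have "\<dots> \<le> 3 / ?w"
        using w by (simp add: field_simps)
      also have "\<dots> = 3 * 3 powr - real_of_int k"
        by (simp add: powr_minus powr_real_of_int' divide_inverse)
      finally show "coarse_grained_norm (\<lambda>x. spikes i x *\<^sub>R mat 1) K ?Q
          \<le> ereal (3 * 3 powr - real_of_int k)"
        by simp
    qed (use assms in auto)
  qed
qed

end
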